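(* Let $p,q>1$ be coprime integers and let $h:\mathbb{T}\to\mathbb{T}$ be an orientation-preserving homeomorphism of $\mathbb{T}=\mathbb{R}/\mathbb{Z}$ with $h(0)=0$. Put $F_p=h\circ f_p\circ h^{-1}$ and $F_q=h\circ f_q\circ h^{-1}$. Suppose that $F_p$ and $F_q$ both preserve the Lebesgue measure and that at least one of $F_p$, $F_q$ has the Lipschitz property. Then $h$ is the identity map.
   Context: For an integer $p>1$, $f_p:\mathbb{T}\to\mathbb{T}$ is $f_p(x)=px\pmod 1$. $\mu_0$ denotes the Lebesgue probability measure on $\mathbb{T}$. The map $F_p$ preserves the Lebesgue measure if $\mu_0(F_p^{-1}(A))=\mu_0(A)$ for every Borel set $A\subseteq\mathbb{T}$. Inverse branches: for $0\le i\le p-1$ let $I_i=[\frac{i}{p},\frac{i+1}{p}]$. Regard $h$ as an increasing homeomorphism of $[0,1]$ (the restriction to $[0,1]$ of the lift $H$ of $h$ to $\mathbb{R}$ with $H(0)=0$, so $H(1)=1$). The inverse branches of $F_p$ are the maps $G_i=(F_p|_{h(I_i)})^{-1}:[0,1]\to h(I_i)$, $0\le i\le p-1$; explicitly, $G_i=h\circ g_i\circ h^{-1}$ with $g_i(x)=\frac{x+i}{p}$ on $[0,1]$. The map $F_p$ has the Lipschitz property if every $G_i$, $0\le i\le p-1$, is a Lipschitz function on $[0,1]$ with Lipschitz constant less than $1$. All the notions for $F_q$ are the same with $q$ in place of $p$. *)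

theory Defs
  imports "HOL-Analysis.Analysis"
begin
quotient_type circle = real / "\<lambda>x y :: real. x - y \<in> \<int>"
  morphisms rep_circle to_circle
proof (rule equivpI)
  show "reflp (\<lambda>x y :: real. x - y \<in> \<int>)"
    by (simp add: reflp_def)
  show "symp (\<lambda>x y :: real. x - y \<in> \<int>)"
    by (rule sympI) (drule Ints_minus, simp)
  show "transp (\<lambda>x y :: real. x - y \<in> \<int>)"
    by (rule transpI) (drule (1) Ints_add, simp)
qed

lemma to_circle_eq_iff: "to_circle x = to_circle y \<longleftrightarrow> x - y \<in> \<int>"
  by (rule circle.abs_eq_iff)

lemma to_circle_surj: "\<exists>x. c = to_circle x"
  by (induction c) auto

instantiation circle :: zero
begin

lift_definition zero_circle :: circle is "0 :: real" .

instance ..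

end

instantiation circle :: topological_space
begin

definition open_circle :: "circle set \<Rightarrow> bool"
  where "open_circle U \<longleftrightarrow> open (to_circle -` U)"

instance
proof
  show "open (UNIV :: circle set)"
    by (simp add: open_circle_def)
  show "open (S \<inter> T)" if "open S" "open T" for S T :: "circle set"
    using that by (simp add: open_circle_def vimage_Int open_Int)
  show "open (\<Union>K)" if "\<forall>S\<in>K. open S" for K :: "circle set set"
    using that by (simp add: open_circle_def vimage_Union open_UN)
qed

end

lemma continuous_on_to_circle: "continuous_on S to_circle"
  by (rule continuous_on_subset[of UNIV])
     (auto simp: continuous_on_open_vimage open_circle_def)

definition circle_lebesgue :: "circle measure"
  where "circle_lebesgue = distr (restrict_space lborel {0..<1}) borel to_circle"

lemma to_circle_measurable: "to_circle \<in> restrict_space lborel {0..<1} \<rightarrow>\<^sub>M borel"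
  by (rule measurable_restrict_space1)
     (auto intro: borel_measurable_continuous_onI continuous_on_to_circle)

lemma emeasure_circle_lebesgue:
  assumes "A \<in> sets borel"
  shows "emeasure circle_lebesgue A = emeasure lborel (to_circle -` A \<inter> {0..<1})"
  using assms to_circle_measurable
  by (simp add: circle_lebesgue_def emeasure_distr emeasure_restrict_space space_restrict_space)

lemma emeasure_circle_lebesgue_UNIV: "emeasure circle_lebesgue UNIV = 1"
  by (simp add: emeasure_circle_lebesgue)

definition preserves_lebesgue :: "(circle \<Rightarrow> circle) \<Rightarrow> bool"
  where "preserves_lebesgue F \<longleftrightarrow>
    (\<forall>A \<in> sets borel. emeasure circle_lebesgue (F -` A) = emeasure circle_lebesgue A)"

definition is_lift :: "(real \<Rightarrow> real) \<Rightarrow> (circle \<Rightarrow> circle) \<Rightarrow> bool"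
  where "is_lift H h \<longleftrightarrow> continuous_on UNIV H \<and> (\<forall>x. to_circle (H x) = h (to_circle x))"

definition orientation_preserving_homeo :: "(circle \<Rightarrow> circle) \<Rightarrow> bool"
  where "orientation_preserving_homeo h \<longleftrightarrow>
    (\<exists>h'. homeomorphism UNIV UNIV h h') \<and> (\<exists>H. is_lift H h \<and> strict_mono H)"

text \<open>Well defined when \<open>h\<close> has a lift and fixes 0: see \<open>normalized_lift\<close> below.\<close>

definition circle_lift :: "(circle \<Rightarrow> circle) \<Rightarrow> real \<Rightarrow> real"
  where "circle_lift h = (THE H. is_lift H h \<and> H 0 = 0)"

lemma lifts_differ_by_int:
  assumes "is_lift H h" "is_lift K h"
  shows "\<exists>n\<in>\<int>. \<forall>x. H x - K x = n"
proof -
  have int: "H x - K x \<in> \<int>" for x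
    using assms by (simp add: is_lift_def flip: to_circle_eq_iff)
  have cont: "continuous_on UNIV (\<lambda>x. H x - K x)"
    using assms by (auto simp: is_lift_def intro: continuous_on_diff)
  have "(\<lambda>x. H x - K x) constant_on UNIV"
  proof (rule continuous_discrete_range_constant[OF connected_UNIV cont])
    fix x :: real
    have "1 \<le> norm ((H y - K y) - (H x - K x))" if "H y - K y \<noteq> H x - K x" for y
      using Ints_nonzero_abs_ge1[OF Ints_diff[OF int[of y] int[of x]]] that by simp
    then show "\<exists>e>0. \<forall>y. y \<in> UNIV \<and> H y - K y \<noteq> H x - K x \<longrightarrow> e \<le> norm ((H y - K y) - (H x - K x))"
      by (intro exI[of _ 1]) auto
  qed
  then show ?thesis
    using int unfolding constant_on_def by auto
qed

lemma orientation_preserving_homeo_inj: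
  assumes "orientation_preserving_homeo h"
  shows "inj h"
proof -
  obtain h' where "homeomorphism UNIV UNIV h h'"
    using assms by (auto simp: orientation_preserving_homeo_def)
  then show ?thesis
    by (intro inj_on_inverseI[of _ h']) (simp add: homeomorphism_def)
qed

lemma normalized_lift:
  assumes "orientation_preserving_homeo h" "h 0 = 0"
  shows "is_lift (circle_lift h) h" "circle_lift h 0 = 0"
    "strict_mono (circle_lift h)" "circle_lift h 1 = 1"
proof -
  obtain K where K: "is_lift K h" "strict_mono K"
    using assms(1) by (auto simp: orientation_preserving_homeo_def)
  define H where "H = (\<lambda>x. K x - K 0)"
  have K0: "K 0 \<in> \<int>"
  proof -
    have "to_circle (K 0) = to_circle 0"
      using K(1) assms(2) by (simp add: is_lift_def flip: zero_circle_def)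
    then show ?thesis
      by (simp add: to_circle_eq_iff)
  qed
  have "to_circle (K x - K 0) = to_circle (K x)" for x
    using K0 by (simp add: to_circle_eq_iff)
  then have "is_lift H h"
    using K(1) by (simp add: is_lift_def H_def continuous_on_diff)
  moreover have "H 0 = 0" "strict_mono H"
    using K(2) by (simp_all add: H_def strict_mono_def)
  ultimately have H: "is_lift H h" "H 0 = 0" "strict_mono H"
    by simp_all
  have "circle_lift h = H"
    unfolding circle_lift_def
  proof (rule the_equality)
    show "is_lift H h \<and> H 0 = 0" using H by simp
    fix J assume J: "is_lift J h \<and> J 0 = 0"
    obtain n where n: "\<And>x. J x - H x = n"
      using lifts_differ_by_int[of J h H] J H(1) by blast
    then have "n = 0" using n[of 0] J H(2) by simp
    then show "J = H" using n by (intro ext) simp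
  qed
  moreover have "H 1 = 1"
  proof (rule ccontr)
    assume "H 1 \<noteq> 1"
    have "to_circle 1 = to_circle 0"
      by (simp add: to_circle_eq_iff)
    then have "to_circle (H 1) = to_circle (H 0)"
      using H(1) by (simp add: is_lift_def)
    then have "H 1 \<in> \<int>" using H(2) by (simp add: to_circle_eq_iff)
    moreover have "0 < H 1" using strict_monoD[OF H(3), of 0 1] H(2) by simp
    ultimately have "1 < H 1"
      using \<open>H 1 \<noteq> 1\<close> by (auto elim!: Ints_cases)
    then obtain t where t: "0 \<le> t" "t \<le> 1" "H t = 1"
    proof -
      have "continuous_on {0..1} H"
        using H(1) by (auto simp: is_lift_def intro: continuous_on_subset)
      then show ?thesis
        using IVT'[of H 0 1 1] \<open>1 < H 1\<close> H(2) that by auto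
    qed
    moreover from t have "t \<noteq> 0" "t \<noteq> 1"
      using H(2) \<open>1 < H 1\<close> by auto
    ultimately have "0 < t" "t < 1"
      by simp_all
    have "to_circle (H t) = to_circle (H 0)"
      using t(3) H(2) by (simp add: to_circle_eq_iff)
    then have "h (to_circle t) = h (to_circle 0)"
      using H(1) by (simp add: is_lift_def)
    moreover have "inj h"
      by (rule orientation_preserving_homeo_inj[OF assms(1)])
    ultimately have "t \<in> \<int>"
      using to_circle_eq_iff[of t 0] by (simp add: inj_eq)
    then show False
      using \<open>0 < t\<close> \<open>t < 1\<close> by (auto elim!: Ints_cases)
  qed
  ultimately show "is_lift (circle_lift h) h" "circle_lift h 0 = 0"
    "strict_mono (circle_lift h)" "circle_lift h 1 = 1"
    using H by simp_all
qed

lift_definition times_map :: "nat \<Rightarrow> circle \<Rightarrow> circle" is "\<lambda>p x. real p * x"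
  by (simp flip: right_diff_distrib)

definition conjugate_map :: "(circle \<Rightarrow> circle) \<Rightarrow> nat \<Rightarrow> circle \<Rightarrow> circle"
  where "conjugate_map h p = h \<circ> times_map p \<circ> inv h"

text \<open>
  On \<open>[0,1]\<close>, with \<open>H = circle_lift h\<close>, this is \<open>H \<circ> g\<^sub>i \<circ> H\<^sup>-\<^sup>1\<close> where
  \<open>g\<^sub>i x = (x + i) / p\<close>; outside \<open>[0,1]\<close> it is meaningless.
\<close>

definition inverse_branch :: "(circle \<Rightarrow> circle) \<Rightarrow> nat \<Rightarrow> nat \<Rightarrow> real \<Rightarrow> real"
  where "inverse_branch h p i x =
    circle_lift h ((the_inv_into {0..1} (circle_lift h) x + real i) / real p)"

lemma circle_lift_bij_betw:
  assumes "orientation_preserving_homeo h" "h 0 = 0"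
  shows "bij_betw (circle_lift h) {0..1} {0..1}"
proof -
  note H = normalized_lift[OF assms]
  have "\<exists>t\<in>{0..1}. circle_lift h t = y" if "y \<in> {0..1}" for y
  proof -
    have "continuous_on {0..1} (circle_lift h)"
      using H(1) by (auto simp: is_lift_def intro: continuous_on_subset)
    then show ?thesis
      using IVT'[of "circle_lift h" 0 y 1] that H(2,4) by auto
  qed
  moreover have "circle_lift h t \<in> {0..1}" if "t \<in> {0..1}" for t
    using that H(2,4) strict_mono_less_eq[OF H(3), of 0 t] strict_mono_less_eq[OF H(3), of t 1]
    by simp
  moreover have "inj_on (circle_lift h) {0..1}"
    by (rule strict_mono_imp_inj_on) (use H(3) in \<open>simp add: strict_mono_on_def strict_mono_def\<close>)
  ultimately show ?thesis
    unfolding bij_betw_def by blast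
qed

lemma conjugate_map_inverse_branch:
  assumes "orientation_preserving_homeo h" "h 0 = 0" "0 < p" "x \<in> {0..1}"
  shows "inverse_branch h p i x \<in> circle_lift h ` {real i / real p..(real i + 1) / real p}"
    "conjugate_map h p (to_circle (inverse_branch h p i x)) = to_circle x"
proof -
  note H = normalized_lift[OF assms(1,2)] and bij = circle_lift_bij_betw[OF assms(1,2)]
  define t where "t = the_inv_into {0..1} (circle_lift h) x"
  have t: "t \<in> {0..1}" "circle_lift h t = x"
    using bij assms(4) the_inv_into_into[of "circle_lift h" "{0..1}" x "{0..1}"]
      f_the_inv_into_f[of "circle_lift h" "{0..1}" x]
    unfolding t_def bij_betw_def by simp_all
  show "inverse_branch h p i x \<in> circle_lift h ` {real i / real p..(real i + 1) / real p}"
    unfolding inverse_branch_def t_def[symmetric]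
    using t(1) assms(3) by (intro imageI) (auto simp: divide_right_mono)
  have "inj h"
    by (rule orientation_preserving_homeo_inj[OF assms(1)])
  have lift: "to_circle (circle_lift h y) = h (to_circle y)" for y
    using H(1) by (simp add: is_lift_def)
  have "conjugate_map h p (to_circle (inverse_branch h p i x)) =
      h (times_map p (to_circle ((t + real i) / real p)))"
    unfolding inverse_branch_def t_def[symmetric] conjugate_map_def
    using \<open>inj h\<close> by (simp add: lift)
  also have "\<dots> = h (to_circle (t + real i))"
    using assms(3) by (simp add: times_map.abs_eq)
  also have "to_circle (t + real i) = to_circle t"
    by (simp add: to_circle_eq_iff)
  also have "h (to_circle t) = to_circle x"
    using lift[of t] t(2) by simp
  finally show "conjugate_map h p (to_circle (inverse_branch h p i x)) = to_circle x" .
qed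

definition lipschitz_property :: "(circle \<Rightarrow> circle) \<Rightarrow> nat \<Rightarrow> bool"
  where "lipschitz_property h p \<longleftrightarrow>
    (\<forall>i<p. \<exists>c<1. c-lipschitz_on {0..1} (inverse_branch h p i))"

end

theory Submission
  imports Defs "HOL-Number_Theory.Residues"
begin

text \<open>
  The argument is Host's. Let \<open>H\<close> be the lift of \<open>h\<close> and \<open>K = H\<^sup>-\<^sup>1\<close> on \<open>[0,1]\<close>, and let \<open>\<nu>\<close> be the
  probability measure with distribution function \<open>H\<close>. It is invariant under multiplication by \<open>q\<close>,
  and the Lipschitz property of \<open>F\<^sub>p\<close> with constant \<open>c < 1\<close> says that
  \<open>\<integral>f d\<nu> \<le> c \<integral>Lf d\<nu>\<close> for \<open>f \<ge> 0\<close>, where \<open>Lf(x) = \<Sum>\<^sub>i f((x+i)/p)\<close>. Choose a power \<open>u\<close> of \<open>q\<close> with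
  \<open>u \<equiv> 1 (mod p\<^sup>2)\<close> and apply this \<open>n\<close> times to \<open>f(x) = |\<Sum>\<^sub>m e(a u\<^sup>m x)|\<^sup>2\<close>, the sum over \<open>m < N = p\<^sup>n\<close>.
  The operator \<open>L\<^sup>n\<close> kills every frequency not divisible by \<open>p\<^sup>n\<close>, and by lifting the exponent
  \<open>p\<^sup>n\<close> divides \<open>a(u\<^sup>i - u\<^sup>j)\<close> for \<open>O(N)\<close> pairs \<open>(i,j)\<close> only, so \<open>\<integral>f d\<nu> = O(c\<^sup>n N\<^sup>2)\<close>. By invariance
  and Cauchy-Schwarz, \<open>N\<^sup>2\<close> times the squared modulus of the \<open>a\<close>-th Fourier coefficient of \<open>\<nu>\<close> is at
  most \<open>\<integral>f d\<nu>\<close>. Hence all nontrivial coefficients vanish, \<open>\<nu>\<close> is Lebesgue measure and \<open>H\<close> is the identity.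
\<close>

subsection \<open>Divisibility of differences of powers\<close>

lemma coprime_add_mult_self_iff:
  fixes c p k :: int
  shows "coprime (c + k * p) p \<longleftrightarrow> coprime c p"
  by (simp add: coprime_iff_gcd_eq_1 gcd.commute[of _ p] add.commute[of c] gcd_add_mult)

text \<open>The induction splits off \<open>g = gcd d p\<close>: since \<open>p\<^sup>2\<close> divides \<open>u - 1\<close>, the quotient
  \<open>(u\<^sup>g - 1) / (u - 1)\<close> is \<open>g\<close> modulo \<open>p\<^sup>2\<close>, hence \<open>g\<close> times a factor coprime to \<open>p\<close>.\<close>

lemma power_minus_one_coprime_part:
  fixes u p :: int and d :: nat
  assumes "p\<^sup>2 dvd u - 1" "d > 0"
  shows "\<exists>x y. coprime x p \<and> coprime y p \<and> (u ^ d - 1) * x = (u - 1) * int d * y"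
  using assms
proof (induction d arbitrary: u rule: less_induct)
  case (less d)
  have geom: "\<exists>w. (\<Sum>i<n. u ^ i) = int n + p\<^sup>2 * w" for n
  proof -
    have "[(\<Sum>i<n. u ^ i) = (\<Sum>i<n. 1 ^ i)] (mod p\<^sup>2)"
      using less.prems(1) by (intro cong_sum cong_pow) (simp add: cong_iff_dvd_diff)
    then have "p\<^sup>2 dvd (\<Sum>i<n. u ^ i) - int n"
      by (simp add: cong_iff_dvd_diff)
    then obtain w where "(\<Sum>i<n. u ^ i) - int n = p\<^sup>2 * w" ..
    then show ?thesis by (intro exI[of _ w]) simp
  qed
  show ?case
  proof (cases "coprime (int d) p")
    case True
    obtain w where w: "(\<Sum>i<d. u ^ i) = int d + p\<^sup>2 * w" using geom by blast
    have "coprime (int d + p\<^sup>2 * w) p"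
      using True coprime_add_mult_self_iff[of "int d" "p * w" p]
      by (simp add: power2_eq_square mult_ac)
    moreover have "(u ^ d - 1) * int d = (u - 1) * int d * (int d + p\<^sup>2 * w)"
      unfolding power_diff_1_eq[of u d] w by (simp only: mult_ac)
    ultimately show ?thesis
      using True by blast
  next
    case False
    define g where "g = nat (gcd (int d) p)"
    have g: "int g = gcd (int d) p" by (simp add: g_def)
    then have "g dvd d" "int g dvd p" by (simp_all flip: int_dvd_int_iff)
    then obtain d' p' where d': "d = g * d'" and p': "p = int g * p'"
      by (metis dvdE)
    have "g \<noteq> 1" using False g by (auto simp: coprime_iff_gcd_eq_1)
    moreover have "g > 0" "d' > 0" using d' less.prems(2) by auto
    ultimately have "d' < d" using d' by simp
    obtain w where w: "(\<Sum>i<g. u ^ i) = int g + p\<^sup>2 * w" using geom by blast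
    have v: "u ^ g - 1 = (u - 1) * int g * (1 + p' * p * w)"
      using power_diff_1_eq[of u g] w p' by (simp add: algebra_simps power2_eq_square)
    then have "p\<^sup>2 dvd u ^ g - 1" using less.prems(1) by simp
    from less.IH[OF \<open>d' < d\<close> this \<open>d' > 0\<close>]
    obtain x y where xy: "coprime x p" "coprime y p"
      "((u ^ g) ^ d' - 1) * x = (u ^ g - 1) * int d' * y" by blast
    have "coprime (1 + p' * p * w) p"
      using coprime_add_mult_self_iff[of 1 "p' * w" p] by (simp add: mult_ac)
    then have "coprime ((1 + p' * p * w) * y) p" using xy(2) by simp
    then show ?thesis
      using xy v d'
      by (intro exI[of _ x] exI[of _ "(1 + p' * p * w) * y"]) (simp add: power_mult)
  qed
qed

text \<open>For \<open>d > 0\<close>, \<open>u ^ d - 1\<close> agrees with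
  \<open>(u - 1) * d\<close> up to factors coprime to \<open>p\<close>: multiplying by
  \<open>x\<close> keeps the divisibility, and \<open>y\<close> cancels.\<close>

lemma power_dvd_power_minus_one:
  fixes u p a :: int and d n :: nat
  assumes "p\<^sup>2 dvd u - 1" "p ^ n dvd a * (u ^ d - 1)"
  shows "p ^ n dvd a * (u - 1) * int d"
proof (cases "d = 0")
  case False
  then obtain x y where xy: "coprime y p" "(u ^ d - 1) * x = (u - 1) * int d * y"
    using power_minus_one_coprime_part[OF assms(1), of d] by auto
  have "p ^ n dvd a * (u ^ d - 1) * x" using assms(2) by simp
  also have "a * (u ^ d - 1) * x = (a * (u - 1) * int d) * y" using xy(2) by (simp add: mult.assoc)
  finally show ?thesis
    using xy(1) by (simp add: coprime_dvd_mult_left_iff coprime_commute)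
qed simp

text \<open>The smaller power of \<open>u\<close> is coprime to \<open>p\<close> and cancels, which
  leaves a factor of the form \<open>u ^ d - 1\<close>.\<close>

lemma power_dvd_diff_powers:
  fixes u p a :: int and i j n :: nat
  assumes "p\<^sup>2 dvd u - 1" "coprime u p" "p ^ n dvd a * (u ^ i - u ^ j)"
  shows "p ^ n dvd a * (u - 1) * (int i - int j)"
proof -
  have *: "p ^ n dvd a * (u - 1) * (int i - int j)"
    if "j \<le> i" "p ^ n dvd a * (u ^ i - u ^ j)" for i j
  proof -
    have "a * (u ^ i - u ^ j) = (a * (u ^ (i - j) - 1)) * u ^ j"
      using that(1) by (simp add: algebra_simps flip: power_add)
    moreover have "coprime (p ^ n) (u ^ j)" using assms(2) by (simp add: coprime_commute)
    ultimately have "p ^ n dvd a * (u ^ (i - j) - 1)"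
      using that(2) coprime_dvd_mult_left_iff by metis
    then show ?thesis
      using power_dvd_power_minus_one[OF assms(1), of n a "i - j"] that(1) by (simp add: of_nat_diff)
  qed
  show ?thesis
  proof (cases "j \<le> i")
    case False
    have "p ^ n dvd a * (u ^ j - u ^ i)"
      using assms(3) by (metis dvd_minus_iff minus_diff_eq mult_minus_right)
    then have "p ^ n dvd a * (u - 1) * (int j - int i)" using * False by simp
    then show ?thesis by (metis dvd_minus_iff minus_diff_eq mult_minus_right)
  qed (use * assms in blast)
qed

text \<open>All products \<open>A * j\<close> with \<open>j\<close> in the set have the same residue
  modulo \<open>M\<close>. Hence \<open>j\<close> is determined by the quotient
  \<open>A * j div M\<close>, which lies below \<open>A\<close>.\<close>

lemma card_dvd_mult_diff_le:
  fixes A M :: nat and c :: int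
  assumes "A > 0"
  shows "card {j. j < M \<and> int M dvd int A * (c - int j)} \<le> A"
proof -
  let ?S = "{j. j < M \<and> int M dvd int A * (c - int j)}"
  have "inj_on (\<lambda>j. A * j div M) ?S"
  proof (rule inj_onI)
    fix i j assume ij: "i \<in> ?S" "j \<in> ?S" and eq: "A * i div M = A * j div M"
    have "int M dvd int A * (c - int i) - int A * (c - int j)"
      using ij by (intro dvd_diff) auto
    then have "int (A * j) mod int M = int (A * i) mod int M"
      by (simp add: mod_eq_dvd_iff algebra_simps)
    then have "A * j mod M = A * i mod M" by (metis of_nat_eq_iff of_nat_mod)
    then have "A * i = A * j" using eq by (metis div_mult_mod_eq)
    then show "i = j" using assms by simp
  qed
  moreover have "(\<lambda>j. A * j div M) ` ?S \<subseteq> {..<A}"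
    by (auto simp: div_less_iff_less_mult) (simp_all add: assms less_mult_imp_div_less)
  ultimately show ?thesis
    using card_inj_on_le[of _ ?S "{..<A}"] by simp
qed

text \<open>Each \<open>i\<close> admits at most \<open>a * (u - 1)\<close> values of
  \<open>j\<close>. This factor does not depend on \<open>n\<close>, so the surviving pairs are
  linear in \<open>p ^ n\<close> out of a quadratic total.\<close>

lemma card_pairs_power_dvd_le:
  fixes u p a n :: nat
  assumes "u > 1" "a > 0" "int p ^ 2 dvd int u - 1" "coprime u p"
  shows "card {(i, j). i < p ^ n \<and> j < p ^ n \<and> int p ^ n dvd int a * (int u ^ i - int u ^ j)}
    \<le> p ^ n * (a * (u - 1))"
proof -
  let ?B = "\<lambda>i. {j. j < p ^ n \<and> int (p ^ n) dvd int (a * (u - 1)) * (int i - int j)}"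
  have "{(i, j). i < p ^ n \<and> j < p ^ n \<and> int p ^ n dvd int a * (int u ^ i - int u ^ j)}
    \<subseteq> Sigma {..<p ^ n} ?B"
    using power_dvd_diff_powers[OF assms(3)] assms by (auto simp: of_nat_diff)
  then have "card {(i, j). i < p ^ n \<and> j < p ^ n \<and> int p ^ n dvd int a * (int u ^ i - int u ^ j)}
    \<le> card (Sigma {..<p ^ n} ?B)"
    by (intro card_mono finite_SigmaI) auto
  also have "\<dots> = (\<Sum>i<p ^ n. card (?B i))"
    by (intro card_SigmaI) auto
  also have "\<dots> \<le> (\<Sum>i<p ^ n. a * (u - 1))"
    using assms by (intro sum_mono card_dvd_mult_diff_le) simp
  finally show ?thesis by simp
qed

text \<open>Euler's theorem modulo \<open>p ^ 2\<close> supplies the exponent.\<close>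

lemma exists_power_cong_one:
  fixes p q :: nat
  assumes "coprime q p" "q > 1" "p > 0"
  shows "\<exists>s>0. q ^ s > 1 \<and> int p ^ 2 dvd int (q ^ s) - 1"
proof (intro exI conjI)
  let ?s = "totient (p ^ 2)"
  show "?s > 0" using assms(3) by simp
  then show "q ^ ?s > 1" using assms(2) one_less_power by blast
  have "coprime q (p ^ 2)" using assms(1) by simp
  then have "[q ^ ?s = 1] (mod (p ^ 2))" by (rule euler_theorem)
  then have "[int (q ^ ?s) = 1] (mod (int (p ^ 2)))" by (metis cong_int_iff of_nat_1)
  then show "int p ^ 2 dvd int (q ^ ?s) - 1" by (simp add: cong_iff_dvd_diff)
qed

subsection \<open>The transfer inequality\<close>

text \<open>A change of variables that never differentiates \<open>G\<close>: on a short interval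
  \<open>\<psi>\<close> is nearly constant, and \<open>G\<close> stretches lengths by at most
  \<open>c\<close>. Bisection passes from short intervals to \<open>{0..1}\<close>.\<close>

lemma integral_lipschitz_subst_le:
  fixes G \<psi> :: "real \<Rightarrow> real"
  assumes lip: "c-lipschitz_on {0..1} G" and mono: "mono_on {0..1} G"
    and cont: "continuous_on {G 0..G 1} \<psi>" and nonneg: "\<And>x. x \<in> {G 0..G 1} \<Longrightarrow> 0 \<le> \<psi> x"
  shows "integral {G 0..G 1} \<psi> \<le> c * integral {0..1} (\<lambda>z. \<psi> (G z))"
proof -
  have c: "0 \<le> c" using lip by (rule lipschitz_on_nonneg)
  have G_mem: "G x \<in> {G 0..G 1}" if "x \<in> {0..1}" for x
    using that mono by (auto intro: mono_onD)
  have contG: "continuous_on {0..1} G" using lip by (rule lipschitz_on_continuous_on)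
  have cont': "continuous_on {0..1} (\<lambda>z. \<psi> (G z))"
    using G_mem by (intro continuous_on_compose2[OF cont contG]) auto
  have int_sub: "\<psi> integrable_on {G s..G t}" "(\<lambda>z. \<psi> (G z)) integrable_on {s..t}"
    if "0 \<le> s" "t \<le> 1" "s \<le> t" for s t
    using that G_mem[of s] G_mem[of t]
    by (auto intro!: integrable_continuous_interval continuous_on_subset[OF cont] continuous_on_subset[OF cont'])
  have "integral {G 0..G 1} \<psi> \<le> c * integral {0..1} (\<lambda>z. \<psi> (G z)) + e" if "e > 0" for e
  proof -
    \<comment> \<open>Bounding \<open>\<psi>\<close> by \<open>\<psi> (G x) + \<epsilon>\<close>
      from above and \<open>\<psi> (G x) - \<epsilon>\<close> from below costs
      \<open>2 * c * \<epsilon>\<close> per unit length. The summand 1 keeps the denominator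
      positive when \<open>c = 0\<close>.\<close>
    define \<epsilon> where "\<epsilon> = e / (2 * (c + 1))"
    have \<epsilon>: "\<epsilon> > 0" "2 * c * \<epsilon> \<le> e"
      using \<open>e > 0\<close> c by (simp_all add: \<epsilon>_def field_simps)
    \<comment> \<open>The error is proportional to the length, so the estimate adds up over adjacent
      intervals, as \<open>Bolzano\<close> requires.\<close>
    define P where "P s t \<longleftrightarrow> (0 \<le> s \<longrightarrow> s \<le> t \<longrightarrow> t \<le> 1 \<longrightarrow>
      integral {G s..G t} \<psi> \<le> c * integral {s..t} (\<lambda>z. \<psi> (G z)) + e * (t - s))" for s t
    have "P 0 1"
    proof (rule Bolzano)
      fix r s t assume P: "P r s" "P s t" "r \<le> s" "s \<le> t"
      show "P r t"
        unfolding P_def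
      proof (intro impI)
        assume rt: "0 \<le> r" "t \<le> 1"
        have "integral {r..s} (\<lambda>z. \<psi> (G z)) + integral {s..t} (\<lambda>z. \<psi> (G z)) = integral {r..t} (\<lambda>z. \<psi> (G z))"
          by (rule Henstock_Kurzweil_Integration.integral_combine) (use P rt in \<open>auto intro: int_sub(2)\<close>)
        moreover have "integral {G r..G s} \<psi> + integral {G s..G t} \<psi> = integral {G r..G t} \<psi>"
          by (rule Henstock_Kurzweil_Integration.integral_combine) (use P rt in \<open>auto intro: int_sub(1) mono_onD[OF mono]\<close>)
        ultimately show "integral {G r..G t} \<psi> \<le> c * integral {r..t} (\<lambda>z. \<psi> (G z)) + e * (t - r)"
          using P rt unfolding P_def by (simp add: algebra_simps) (smt (verit) distrib_left)
      qed
    next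
      fix x :: real assume x: "0 \<le> x" "x \<le> 1"
      obtain d1 where d1: "d1 > 0" "\<And>y. y \<in> {G 0..G 1} \<Longrightarrow> dist y (G x) < d1 \<Longrightarrow> dist (\<psi> y) (\<psi> (G x)) < \<epsilon>"
        using cont G_mem[of x] x \<epsilon>(1) unfolding continuous_on_iff by (metis atLeastAtMost_iff)
      \<comment> \<open>An interval shorter than \<open>d\<close> has an image under
        \<open>G\<close> shorter than \<open>d1\<close>.\<close>
      define d where "d = d1 / (c + 1)"
      have "d > 0" using d1 c by (simp add: d_def)
      have "P s t" if st: "s \<le> x" "x \<le> t" "t - s < d" for s t
        unfolding P_def
      proof (intro impI)
        assume st': "0 \<le> s" "s \<le> t" "t \<le> 1"
        have le: "G s \<le> G t" using st' by (intro mono_onD[OF mono]) auto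
        have Gdiff: "G t - G s \<le> c * (t - s)"
          using lipschitz_onD[OF lip, of t s] st' le by (simp add: dist_real_def)
        have "c * (t - s) \<le> c * d" using st c by (intro mult_left_mono) auto
        also have "\<dots> < d1" using c d1(1) by (simp add: d_def field_simps)
        finally have small: "G t - G s < d1" using Gdiff by simp
        have near: "\<bar>\<psi> y - \<psi> (G x)\<bar> < \<epsilon>" if "y \<in> {G s..G t}" for y
        proof -
          have "G x \<in> {G s..G t}" using st st' by (auto intro: mono_onD[OF mono])
          then have "dist y (G x) < d1" using that small by (auto simp: dist_real_def)
          moreover have "y \<in> {G 0..G 1}" using that G_mem[of s] G_mem[of t] st' by auto
          ultimately show ?thesis using d1(2) by (simp add: dist_real_def)
        qed
        have "integral {G s..G t} \<psi> \<le> integral {G s..G t} (\<lambda>_. \<psi> (G x) + \<epsilon>)"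
          proof (intro integral_le int_sub)
          fix y assume "y \<in> {G s..G t}"
          then show "\<psi> y \<le> \<psi> (G x) + \<epsilon>" using near[of y] by linarith
        qed (use st' in auto)
        also have "\<dots> = (G t - G s) * (\<psi> (G x) + \<epsilon>)" using le by simp
        also have "\<dots> \<le> c * (t - s) * (\<psi> (G x) + \<epsilon>)"
          using Gdiff nonneg[OF G_mem, of x] x \<epsilon> by (intro mult_right_mono) auto
        finally have upper: "integral {G s..G t} \<psi> \<le> c * (t - s) * (\<psi> (G x) + \<epsilon>)" .
        have "(t - s) * (\<psi> (G x) - \<epsilon>) = integral {s..t} (\<lambda>_. \<psi> (G x) - \<epsilon>)"
          using st' by simp
        also have "\<dots> \<le> integral {s..t} (\<lambda>z. \<psi> (G z))"
        proof (intro integral_le int_sub)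
          fix z assume "z \<in> {s..t}"
          then have "G z \<in> {G s..G t}" using st' by (auto intro: mono_onD[OF mono])
          then show "\<psi> (G x) - \<epsilon> \<le> \<psi> (G z)" using near[of "G z"] by linarith
        qed (use st' in auto)
        finally have "c * ((t - s) * (\<psi> (G x) - \<epsilon>)) \<le> c * integral {s..t} (\<lambda>z. \<psi> (G z))"
          using c by (intro mult_left_mono)
        then have "integral {G s..G t} \<psi> \<le> c * integral {s..t} (\<lambda>z. \<psi> (G z)) + 2 * c * \<epsilon> * (t - s)"
          using upper by (simp add: algebra_simps)
        also have "\<dots> \<le> c * integral {s..t} (\<lambda>z. \<psi> (G z)) + e * (t - s)"
          using \<epsilon>(2) st' by (intro add_left_mono mult_right_mono) auto
        finally show "integral {G s..G t} \<psi> \<le> c * integral {s..t} (\<lambda>z. \<psi> (G z)) + e * (t - s)" .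
      qed
      then show "\<exists>d>0. \<forall>a b. a \<le> x \<and> x \<le> b \<and> b - a < d \<longrightarrow> P a b"
        using \<open>d > 0\<close> by blast
    qed simp
    then show ?thesis by (simp add: P_def)
  qed
  then show ?thesis by (rule field_le_epsilon)
qed

text \<open>If \<open>p\<close> divides \<open>b\<close>, all summands coincide. Otherwise they are
  the real parts of a geometric sum over the powers of a nontrivial \<open>p\<close>-th root of
  unity.\<close>

lemma sum_cos_translates:
  fixes b :: int and p :: nat and x :: real
  assumes "p > 0"
  shows "(\<Sum>i<p. cos (2 * pi * b * ((x + real i) / p))) =
    (if int p dvd b then p * cos (2 * pi * (b div int p) * x) else 0)"
proof (cases "int p dvd b")
  case True
  then obtain k where k: "b = int p * k" ..
  have "cos (2 * pi * b * ((x + real i) / p)) = cos (2 * pi * k * x)" for i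
  proof -
    have "2 * pi * b * ((x + real i) / p) = 2 * pi * k * x + 2 * pi * (k * int i)"
      using assms k by (simp add: field_simps)
    then show ?thesis
      using cos_int_2pin[of "k * int i"] sin_int_2pin[of "k * int i"] by (simp add: cos_add)
  qed
  then show ?thesis using k assms by simp
next
  case False
  define w where "w = cis (2 * pi * b / p)"
  have "w ^ p = cis (real p * (2 * pi * b / p))" by (simp only: w_def Complex.DeMoivre)
  also have "real p * (2 * pi * b / p) = 2 * pi * b" using assms by simp
  finally have "w ^ p = 1" by simp
  have "w \<noteq> 1"
  proof
    assume "w = 1"
    then have "cos (2 * pi * b / p) = 1" by (simp add: w_def complex_eq_iff)
    then obtain n :: int where "2 * pi * b / p = n * 2 * pi" 
      by (auto simp: cos_one_2pi_int)
    then have "real_of_int b = real_of_int (n * int p)"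
      using assms by (simp add: field_simps)
    then have "b = n * int p" by (simp only: of_int_eq_iff)
    then show False using False by simp
  qed
  have "(\<Sum>i<p. cis (2 * pi * b * ((x + real i) / p))) = (\<Sum>i<p. cis (2 * pi * b * x / p) * w ^ i)"
    by (intro sum.cong) (auto simp: w_def Complex.DeMoivre cis_mult field_simps)
  also have "\<dots> = 0"
    using \<open>w ^ p = 1\<close> \<open>w \<noteq> 1\<close> geometric_sum[of w p] by (simp flip: sum_distrib_left)
  finally have "Re (\<Sum>i<p. cis (2 * pi * b * ((x + real i) / p))) = 0" by simp
  then show ?thesis using False by simp
qed

text \<open>\<open>H\<close> is the distribution function of \<nu> and \<open>K\<close> its quantile
  function. All conditions stay within \<open>{0..1}\<close>, since the intended \<open>K\<close> is
  \<open>the_inv_into {0..1}\<close>, which is unspecified elsewhere.\<close>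

locale unit_interval_homeo =
  fixes H K :: "real \<Rightarrow> real"
  assumes H_mono: "mono_on {0..1} H" and H_0: "H 0 = 0" and H_1: "H 1 = 1"
    and K_cont: "continuous_on {0..1} K"
    and K_mem: "\<And>y. y \<in> {0..1} \<Longrightarrow> K y \<in> {0..1}"
    and K_H: "\<And>x. x \<in> {0..1} \<Longrightarrow> K (H x) = x"
    and H_K: "\<And>y. y \<in> {0..1} \<Longrightarrow> H (K y) = y"
begin

lemma K_0: "K 0 = 0" and K_1: "K 1 = 1"
  using K_H[of 0] K_H[of 1] H_0 H_1 by simp_all

lemma H_mem: "H x \<in> {0..1}" if "x \<in> {0..1}"
  using mono_onD[OF H_mono, of 0 x] mono_onD[OF H_mono, of x 1] that H_0 H_1 by auto

lemma K_mono: "mono_on {0..1} K"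
proof (rule mono_onI)
  fix x y :: real assume xy: "x \<in> {0..1}" "y \<in> {0..1}" "x \<le> y"
  show "K x \<le> K y"
  proof (rule ccontr)
    assume *: "\<not> K x \<le> K y"
    then have "H (K y) \<le> H (K x)" using xy K_mem by (intro mono_onD[OF H_mono]) auto
    then have "x = y" using xy H_K by simp
    then show False using * by simp
  qed
qed

text \<open>This is \<open>\<integral>f d\<nu>\<close>, because \<open>K\<close> pushes Lebesgue measure forward to \<open>\<nu>\<close>.\<close>

definition avg :: "(real \<Rightarrow> real) \<Rightarrow> real"
  where "avg f = integral {0..1} (\<lambda>y. f (K y))"

lemma integrable_K:
  fixes f :: "real \<Rightarrow> real"
  assumes "continuous_on UNIV f"
  shows "(\<lambda>y. f (K y)) integrable_on {0..1}"
  by (intro integrable_continuous_interval continuous_on_compose2[OF assms K_cont]) auto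

lemma avg_sum:
  assumes "finite A" "\<And>k. k \<in> A \<Longrightarrow> continuous_on UNIV (f k)"
  shows "avg (\<lambda>x. \<Sum>k\<in>A. f k x) = (\<Sum>k\<in>A. avg (f k))"
  unfolding avg_def using assms by (intro integral_sum integrable_K) auto

lemma avg_add:
  assumes "continuous_on UNIV f" "continuous_on UNIV g"
  shows "avg (\<lambda>x. f x + g x) = avg f + avg g"
  unfolding avg_def using assms by (intro integral_add integrable_K) auto

lemma avg_mono:
  assumes "continuous_on UNIV f" "continuous_on UNIV g" "\<And>x. f x \<le> g x"
  shows "avg f \<le> avg g"
  unfolding avg_def using assms by (intro integral_le integrable_K) auto

lemma avg_cmult: "avg (\<lambda>x. c * f x) = c * avg f"
  by (simp add: avg_def)

lemma avg_const: "avg (\<lambda>x. c) = c"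
  by (simp add: avg_def)

text \<open>Average the inequality \<open>2 * t * g x \<le> (g x)\<^sup>2 + t\<^sup>2\<close> with
  \<open>t\<close> the mean of \<open>g\<close>.\<close>

lemma avg_square_le:
  assumes "continuous_on UNIV g"
  shows "(avg g)\<^sup>2 \<le> avg (\<lambda>x. (g x)\<^sup>2)"
proof -
  define t where "t = avg g"
  have "avg (\<lambda>x. 2 * t * g x) \<le> avg (\<lambda>x. (g x)\<^sup>2 + t\<^sup>2)"
  proof (rule avg_mono)
    show "2 * t * g x \<le> (g x)\<^sup>2 + t\<^sup>2" for x
      using sum_squares_bound[of t "g x"] by simp
  qed (intro continuous_intros assms)+
  also have "\<dots> = avg (\<lambda>x. (g x)\<^sup>2) + t\<^sup>2"
    using avg_add[of "\<lambda>x. (g x)\<^sup>2" "\<lambda>_. t\<^sup>2"] assms by (simp add: avg_const continuous_on_power)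
  finally show ?thesis
    by (simp add: avg_cmult t_def power2_eq_square)
qed

text \<open>The images of the branches \<open>G\<close> tile \<open>{0..1}\<close> from left to
  right, and \<open>K (G z) = (K z + i) / p\<close>. The induction adds one tile at a time, each by
  the substitution inequality applied to \<open>f \<circ> K\<close>.\<close>

lemma avg_le_transfer:
  assumes p: "p > 0"
    and lip: "\<And>i. i < p \<Longrightarrow> c-lipschitz_on {0..1} (\<lambda>x. H ((K x + real i) / p))"
    and cont: "continuous_on UNIV f" and nonneg: "\<And>x. 0 \<le> f x"
  shows "avg f \<le> c * avg (\<lambda>x. \<Sum>i<p. f ((x + real i) / p))"
proof -
  have int: "(\<lambda>y. f (K y)) integrable_on {s..t}" if "0 \<le> s" "t \<le> 1" for s t
    by (rule integrable_on_subinterval[OF integrable_K[OF cont]]) (use that in auto)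
  have "integral {0..H (real k / p)} (\<lambda>y. f (K y)) \<le> c * (\<Sum>i<k. avg (\<lambda>x. f ((x + real i) / p)))"
    if "k \<le> p" for k
    using that
  proof (induction k)
    case 0
    then show ?case by (simp add: H_0)
  next
    case (Suc k)
    define G where "G x = H ((K x + real k) / p)" for x
    have frac: "(K x + real k) / p \<in> {0..1}" if "x \<in> {0..1}" for x
    proof -
      have "K x \<le> 1" "0 \<le> K x" "real k + 1 \<le> real p" using K_mem[OF that] Suc.prems by auto
      then show ?thesis using p by (simp add: field_simps)
    qed
    have G01: "G 0 = H (real k / p)" "G 1 = H (real (Suc k) / p)"
      by (simp_all add: G_def K_0 K_1 add.commute)
    have Gmono: "mono_on {0..1} G"
      unfolding G_def
      by (intro mono_onI mono_onD[OF H_mono] frac)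
        (auto intro!: divide_right_mono mono_onD[OF K_mono])
    have G_mem: "G x \<in> {0..1}" if "x \<in> {0..1}" for x
      unfolding G_def using frac[OF that] by (rule H_mem)
    have "integral {G 0..G 1} (\<lambda>y. f (K y)) \<le> c * integral {0..1} (\<lambda>z. f (K (G z)))"
    proof (rule integral_lipschitz_subst_le[OF _ Gmono])
      show "c-lipschitz_on {0..1} G" unfolding G_def using Suc.prems by (intro lip) auto
      show "continuous_on {G 0..G 1} (\<lambda>y. f (K y))"
        using G_mem[of 0] G_mem[of 1]
        by (intro continuous_on_compose2[OF cont] continuous_on_subset[OF K_cont]) auto
    qed (use nonneg in auto)
    also have "integral {0..1} (\<lambda>z. f (K (G z))) = avg (\<lambda>x. f ((x + real k) / p))"
      unfolding avg_def G_def by (intro integral_cong arg_cong[where f = f] K_H frac)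
    finally have step: "integral {G 0..G 1} (\<lambda>y. f (K y)) \<le> c * avg (\<lambda>x. f ((x + real k) / p))" .
    have "G 0 \<le> G 1" by (rule mono_onD[OF Gmono]) auto
    then have "integral {0..G 0} (\<lambda>y. f (K y)) + integral {G 0..G 1} (\<lambda>y. f (K y)) =
        integral {0..G 1} (\<lambda>y. f (K y))"
      using G_mem[of 0] G_mem[of 1]
      by (intro Henstock_Kurzweil_Integration.integral_combine int) auto
    then show ?case
      using Suc step by (simp add: G01 distrib_left)
  qed
  from this[of p] show ?thesis
    using p by (subst avg_sum) (auto intro!: continuous_intros continuous_on_compose2[OF cont]
        simp: H_1 avg_def[of f])
qed

text \<open>Each transfer step discards the frequencies not divisible by \<open>p\<close>, divides
  the others by \<open>p\<close> and costs a factor \<open>c * p\<close>. After \<open>n\<close>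
  steps every surviving cosine is bounded by 1.\<close>

lemma avg_sum_cos_le:
  fixes b :: "'k \<Rightarrow> int"
  assumes p: "p > 0"
    and lip: "\<And>i. i < p \<Longrightarrow> c-lipschitz_on {0..1} (\<lambda>x. H ((K x + real i) / p))"
    and "finite A" "\<And>x. 0 \<le> (\<Sum>k\<in>A. cos (2 * pi * b k * x))"
  shows "avg (\<lambda>x. \<Sum>k\<in>A. cos (2 * pi * b k * x)) \<le> (c * p) ^ n * card {k \<in> A. int p ^ n dvd b k}"
  using assms(3,4)
proof (induction n arbitrary: A b)
  case 0
  have "avg (\<lambda>x. \<Sum>k\<in>A. cos (2 * pi * b k * x)) \<le> avg (\<lambda>x. \<Sum>k\<in>A. 1)"
    by (intro avg_mono sum_mono) (auto intro!: continuous_intros)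
  then show ?case by (simp add: avg_const)
next
  case (Suc n)
  have c: "0 \<le> c" using lip[of 0] p lipschitz_on_nonneg by blast
  let ?B = "{k \<in> A. int p dvd b k}"
  let ?f = "\<lambda>x. \<Sum>k\<in>?B. cos (2 * pi * (b k div int p) * x)"
  have L: "(\<Sum>i<p. \<Sum>k\<in>A. cos (2 * pi * b k * ((x + real i) / p))) = p * ?f x" for x
  proof -
    have "(\<Sum>i<p. \<Sum>k\<in>A. cos (2 * pi * b k * ((x + real i) / p))) =
      (\<Sum>k\<in>A. \<Sum>i<p. cos (2 * pi * b k * ((x + real i) / p)))" by (rule sum.swap)
    also have "\<dots> = (\<Sum>k\<in>A. if int p dvd b k then p * cos (2 * pi * (b k div int p) * x) else 0)"
      using p by (simp only: sum_cos_translates)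
    also have "\<dots> = (\<Sum>k\<in>?B. p * cos (2 * pi * (b k div int p) * x))"
      using Suc.prems(1) by (subst sum.inter_filter) auto
    finally show ?thesis by (simp add: sum_distrib_left)
  qed
  \<comment> \<open>Nonnegativity passes to the surviving sum, because \<open>p\<close> times it is
    a sum of values of the old one. This lets the transfer inequality be iterated.\<close>
  have "0 \<le> real p * ?f x" for x
    unfolding L[symmetric] by (rule sum_nonneg) (rule Suc.prems)
  then have "0 \<le> ?f x" for x using p by (simp add: zero_le_mult_iff)
  then have IH: "avg ?f \<le> (c * p) ^ n * card {k \<in> ?B. int p ^ n dvd b k div int p}"
    using Suc.prems(1) by (intro Suc.IH) auto
  have "{k \<in> ?B. int p ^ n dvd b k div int p} = {k \<in> A. int p ^ Suc n dvd b k}"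
    using p by (auto simp: dvd_def elim!: dvdE)
  note IH = IH[unfolded this]
  have "avg (\<lambda>x. \<Sum>k\<in>A. cos (2 * pi * b k * x)) \<le>
      c * avg (\<lambda>x. \<Sum>i<p. \<Sum>k\<in>A. cos (2 * pi * b k * ((x + real i) / p)))"
  proof (rule avg_le_transfer[OF p lip])
    show "continuous_on UNIV (\<lambda>x. \<Sum>k\<in>A. cos (2 * pi * b k * x))" by (intro continuous_intros)
  qed (assumption | rule Suc.prems(2))+
  also have "\<dots> = c * p * avg ?f" unfolding L avg_cmult by simp
  also have "\<dots> \<le> c * p * ((c * p) ^ n * card {k \<in> A. int p ^ Suc n dvd b k})"
    using IH c by (intro mult_left_mono) auto
  finally show ?case by (simp add: mult_ac)
qed

section \<open>Vanishing of the nontrivial Fourier coefficients\<close>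

lemma fourier_coefficients_vanish:
  fixes p q a :: nat
  assumes pq: "p > 1" "q > 1" "coprime p q" and "c < 1" "a > 0"
    and lip: "\<And>i. i < p \<Longrightarrow> c-lipschitz_on {0..1} (\<lambda>x. H ((K x + real i) / p))"
    and inv_cos: "\<And>a. avg (\<lambda>x. cos (2 * pi * real (q * a) * x)) = avg (\<lambda>x. cos (2 * pi * real a * x))"
    and inv_sin: "\<And>a. avg (\<lambda>x. sin (2 * pi * real (q * a) * x)) = avg (\<lambda>x. sin (2 * pi * real a * x))"
  shows "avg (\<lambda>x. cos (2 * pi * a * x)) = 0" "avg (\<lambda>x. sin (2 * pi * a * x)) = 0"
proof -
  define C where "C = avg (\<lambda>x. cos (2 * pi * a * x))"
  define S where "S = avg (\<lambda>x. sin (2 * pi * a * x))"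
  have c: "0 \<le> c" using lip[of 0] pq lipschitz_on_nonneg by fastforce
  obtain s where s: "q ^ s > 1" "int p ^ 2 dvd int (q ^ s) - 1"
    using exists_power_cong_one[of q p] pq by (auto simp: coprime_commute)
  define u where "u = q ^ s"
  have u: "u > 1" "int p ^ 2 dvd int u - 1" "coprime u p"
    using s pq by (simp_all add: u_def coprime_commute)
  have q_cos: "avg (\<lambda>x. cos (2 * pi * real (q ^ m * a) * x)) = C" for m
  proof (induction m)
    case (Suc m)
    then show ?case using inv_cos[of "q ^ m * a"] by (simp add: mult.assoc)
  qed (simp add: C_def)
  have q_sin: "avg (\<lambda>x. sin (2 * pi * real (q ^ m * a) * x)) = S" for m
  proof (induction m)
    case (Suc m)
    then show ?case using inv_sin[of "q ^ m * a"] by (simp add: mult.assoc)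
  qed (simp add: S_def)
  \<comment> \<open>Powers of \<open>u\<close> are powers of \<open>q\<close>, so invariance
    iterated \<open>s * m\<close> times reaches the frequency \<open>a * u ^ m\<close>.\<close>
  have qu: "q ^ (s * m) * a = a * u ^ m" for m
    by (simp add: u_def power_mult)
  have u_cos: "avg (\<lambda>x. cos (2 * pi * real (a * u ^ m) * x)) = C" for m
    using q_cos[of "s * m"] unfolding qu .
  have u_sin: "avg (\<lambda>x. sin (2 * pi * real (a * u ^ m) * x)) = S" for m
    using q_sin[of "s * m"] unfolding qu .
  have bound: "C\<^sup>2 + S\<^sup>2 \<le> c ^ n * (a * (u - 1))" for n
  proof -
    define N where "N = p ^ n"
    have N: "N > 0" using pq by (simp add: N_def)
    \<comment> \<open>\<open>f\<close> and \<open>g\<close> are the real and imaginary parts of the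
      exponential sum, and \<open>b\<close> gives the frequency differences in its squared
      modulus.\<close>
    define f where "f x = (\<Sum>m<N. cos (2 * pi * real (a * u ^ m) * x))" for x
    define g where "g x = (\<Sum>m<N. sin (2 * pi * real (a * u ^ m) * x))" for x
    define b :: "nat \<times> nat \<Rightarrow> int" where "b = (\<lambda>(i, j). int a * (int u ^ i - int u ^ j))"
    let ?A = "{..<N} \<times> {..<N}"
    have cont: "continuous_on UNIV f" "continuous_on UNIV g"
      unfolding f_def g_def by (intro continuous_intros)+
    have fg: "(f x)\<^sup>2 + (g x)\<^sup>2 = (\<Sum>k\<in>?A. cos (2 * pi * b k * x))" for x
    proof -
      have "(f x)\<^sup>2 + (g x)\<^sup>2 = (\<Sum>i<N. \<Sum>j<N.
        cos (2 * pi * real (a * u ^ i) * x) * cos (2 * pi * real (a * u ^ j) * x) +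
        sin (2 * pi * real (a * u ^ i) * x) * sin (2 * pi * real (a * u ^ j) * x))"
        by (simp add: f_def g_def power2_eq_square sum_product sum.distrib)
      also have "\<dots> = (\<Sum>i<N. \<Sum>j<N. cos (2 * pi * b (i, j) * x))"
        by (intro sum.cong refl) (simp add: b_def algebra_simps flip: cos_diff)
      finally show ?thesis by (simp add: sum.cartesian_product)
    qed
    have card: "card {k \<in> ?A. int p ^ n dvd b k} \<le> N * (a * (u - 1))"
    proof -
      have "{k \<in> ?A. int p ^ n dvd b k} =
          {(i, j). i < p ^ n \<and> j < p ^ n \<and> int p ^ n dvd int a * (int u ^ i - int u ^ j)}"
        by (auto simp: b_def N_def)
      then show ?thesis
        using card_pairs_power_dvd_le[OF u(1) \<open>a > 0\<close> u(2,3)] by (simp add: N_def)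
    qed
    \<comment> \<open>By invariance every term of \<open>f\<close> averages to \<open>C\<close> and
      every term of \<open>g\<close> to \<open>S\<close>.\<close>
    have "(N * C)\<^sup>2 + (N * S)\<^sup>2 = (avg f)\<^sup>2 + (avg g)\<^sup>2"
      unfolding f_def g_def by (subst (1 2) avg_sum) (auto intro!: continuous_intros simp: u_cos[simplified] u_sin[simplified])
    also have "\<dots> \<le> avg (\<lambda>x. (f x)\<^sup>2) + avg (\<lambda>x. (g x)\<^sup>2)"
      using cont by (intro add_mono avg_square_le)
    also have "\<dots> = avg (\<lambda>x. \<Sum>k\<in>?A. cos (2 * pi * b k * x))"
      unfolding fg[symmetric] by (rule avg_add[symmetric]) (intro continuous_intros cont)+
    also have "\<dots> \<le> (c * p) ^ n * card {k \<in> ?A. int p ^ n dvd b k}"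
    proof (rule avg_sum_cos_le[OF _ lip])
      show "0 \<le> (\<Sum>k\<in>?A. cos (2 * pi * b k * x))" for x
        unfolding fg[symmetric] by simp
    qed (use pq in auto)
    also have "\<dots> \<le> (c * p) ^ n * real (N * (a * (u - 1)))"
      using card c by (intro mult_left_mono) (auto simp del: of_nat_mult)
    \<comment> \<open>The \<open>p ^ n\<close> inside \<open>(c * p) ^ n\<close> and the
      \<open>N\<close> from the count of pairs combine to \<open>N\<^sup>2\<close>, leaving the
      decaying factor \<open>c ^ n\<close>.\<close>
    also have "\<dots> = (real N)\<^sup>2 * (c ^ n * (a * (u - 1)))"
      by (simp add: N_def power_mult_distrib power2_eq_square mult_ac)
    finally have "(real N)\<^sup>2 * (C\<^sup>2 + S\<^sup>2) \<le> (real N)\<^sup>2 * (c ^ n * (a * (u - 1)))"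
      by (simp add: power_mult_distrib distrib_left)
    then show ?thesis using N by simp
  qed
  have "(\<lambda>n. c ^ n * (a * (u - 1))) \<longlonglongrightarrow> 0 * real (a * (u - 1))"
    using c \<open>c < 1\<close> by (intro tendsto_mult_right LIMSEQ_realpow_zero) auto
  then have "C\<^sup>2 + S\<^sup>2 \<le> 0"
    using bound by (intro LIMSEQ_le_const[where X = "\<lambda>n. c ^ n * (a * (u - 1))"]) auto
  then have "C = 0" "S = 0" by (simp_all add: sum_power2_le_zero_iff)
  then show "avg (\<lambda>x. cos (2 * pi * a * x)) = 0" "avg (\<lambda>x. sin (2 * pi * a * x)) = 0"
    by (simp_all add: C_def S_def)
qed

end

subsection \<open>Uniqueness of Fourier coefficients\<close>

inductive trig_polynomial :: "(real \<Rightarrow> complex) \<Rightarrow> bool" where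
  monomial: "trig_polynomial (\<lambda>x. c * cis (2 * pi * of_int k * x))"
| add: "trig_polynomial f \<Longrightarrow> trig_polynomial g \<Longrightarrow> trig_polynomial (\<lambda>x. f x + g x)"

lemma trig_polynomial_const: "trig_polynomial (\<lambda>x. c)"
  using trig_polynomial.monomial[of c 0] by simp

lemma trig_polynomial_mult:
  assumes "trig_polynomial f" "trig_polynomial g"
  shows "trig_polynomial (\<lambda>x. f x * g x)"
  using assms(1)
proof induction
  case (monomial c k)
  from assms(2) show ?case
  proof induction
    case (monomial c' k')
    have "(\<lambda>x. c * cis (2 * pi * of_int k * x) * (c' * cis (2 * pi * of_int k' * x))) =
        (\<lambda>x. (c * c') * cis (2 * pi * of_int (k + k') * x))"
      by (simp add: fun_eq_iff distrib_left distrib_right mult_ac flip: cis_mult)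
    then show ?case by (simp only: trig_polynomial.monomial)
  qed (simp add: distrib_left trig_polynomial.add)
qed (simp add: distrib_right trig_polynomial.add)

text \<open>A real-linear map is determined by its values at 1 and \<open>\<i>\<close>, and by
  Euler's formulas cosine and sine are combinations of the frequencies 1 and -1. The other cases are
  closure properties.\<close>

lemma trig_polynomial_of_real_polynomial:
  fixes g :: "complex \<Rightarrow> real"
  assumes "real_polynomial_function g"
  shows "trig_polynomial (\<lambda>x. of_real (g (cis (2 * pi * x))))"
  using assms
proof induction
  case (linear g)
  interpret bounded_linear g by (rule linear)
  let ?a = "complex_of_real (g 1)" and ?b = "complex_of_real (g \<i>)"
  have g: "g (cis t) = cos t * g 1 + sin t * g \<i>" for t
  proof -
    have "cis t = cos t *\<^sub>R 1 + sin t *\<^sub>R \<i>" by (simp add: complex_eq_iff)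
    then show ?thesis by (simp add: add scaleR)
  qed
  have "complex_of_real (g (cis (2 * pi * x))) =
      (?a - \<i> * ?b) / 2 * cis (2 * pi * of_int 1 * x) + (?a + \<i> * ?b) / 2 * cis (2 * pi * of_int (-1) * x)"
    for x
    unfolding g by (simp add: complex_eq_iff field_simps)
  then show ?case
    by (simp only:) (intro trig_polynomial.intros)
qed (simp_all add: trig_polynomial_const trig_polynomial.add trig_polynomial_mult)

lemma has_integral_cis_0:
  fixes k :: int
  assumes "k \<noteq> 0"
  shows "((\<lambda>x. cis (2 * pi * k * x)) has_integral 0) {0..1}"
proof -
  let ?F = "\<lambda>x. cis (2 * pi * k * x) / (\<i> * (2 * pi * k))"
  have "(?F has_vector_derivative cis (2 * pi * k * x)) (at x within {0..1})" for x :: real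
  proof -
    have "((\<lambda>z. exp (\<i> * (2 * pi * k * z)) / (\<i> * (2 * pi * k))) has_field_derivative
        exp (\<i> * (2 * pi * k * of_real x))) (at (of_real x))"
      using assms by (auto intro!: derivative_eq_intros)
    from has_vector_derivative_real_field[OF this] show ?thesis
      by (simp add: cis_conv_exp)
  qed
  then have "((\<lambda>x. cis (2 * pi * k * x)) has_integral ?F 1 - ?F 0) {0..1}"
    by (intro fundamental_theorem_of_calculus) auto
  moreover have "?F 1 = ?F 0" by simp
  ultimately show ?thesis by simp
qed

section \<open>Identification of \<nu> with Lebesgue measure\<close>

context unit_interval_homeo
begin

context
  assumes avg_cos_0: "\<And>a::nat. a > 0 \<Longrightarrow> avg (\<lambda>x. cos (2 * pi * a * x)) = 0"
    and avg_sin_0: "\<And>a::nat. a > 0 \<Longrightarrow> avg (\<lambda>x. sin (2 * pi * a * x)) = 0"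
begin

lemma has_integral_cis_K_0:
  fixes k :: int
  assumes "k \<noteq> 0"
  shows "((\<lambda>y. cis (2 * pi * k * K y)) has_integral 0) {0..1}"
proof -
  have *: "((\<lambda>y. f (K y)) has_integral 0) {0..1}" if "continuous_on UNIV f" "avg f = 0" for f
    using integrable_integral[OF integrable_K[OF that(1)]] that(2) by (simp add: avg_def)
  \<comment> \<open>The assumptions cover positive frequencies. Since cosine is even and sine is
    odd, negative ones differ only by the sign \<open>sgn k\<close>.\<close>
  define n where "n = nat \<bar>k\<bar>"
  have n: "n > 0" using assms by (simp add: n_def)
  have c: "((\<lambda>y. cos (2 * pi * n * K y)) has_integral 0) {0..1}"
    by (rule *) (use n in \<open>auto intro!: continuous_intros avg_cos_0\<close>)
  have s: "((\<lambda>y. sin (2 * pi * n * K y)) has_integral 0) {0..1}"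
    by (rule *) (use n in \<open>auto intro!: continuous_intros avg_sin_0\<close>)
  have "((\<lambda>y. complex_of_real (cos (2 * pi * n * K y)) +
      of_int (sgn k) * \<i> * complex_of_real (sin (2 * pi * n * K y))) has_integral
      0 + of_int (sgn k) * \<i> * 0) {0..1}"
    using has_integral_linear[OF c bounded_linear_of_real[where 'a = complex]]
      has_integral_linear[OF s bounded_linear_of_real[where 'a = complex]]
    by (intro has_integral_add has_integral_mult_right) (simp_all add: o_def)
  moreover have "cis (2 * pi * k * K y) = complex_of_real (cos (2 * pi * n * K y)) +
      of_int (sgn k) * \<i> * complex_of_real (sin (2 * pi * n * K y))" for y
    using assms by (cases "k > 0") (simp_all add: n_def complex_eq_iff)
  ultimately show ?thesis by simp
qed

text \<open>A shared value \<open>z\<close> carries integrability and equality of the two integrals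
  through the induction together.\<close>

lemma trig_polynomial_has_integral:
  assumes "trig_polynomial f"
  shows "\<exists>z. ((\<lambda>y. f (K y)) has_integral z) {0..1} \<and> (f has_integral z) {0..1}"
  using assms
proof induction
  case (monomial c k)
  show ?case
  proof (cases "k = 0")
    case True
    then show ?thesis
      using has_integral_const_real[of c 0 1] by auto
  next
    case False
    then show ?thesis
      using has_integral_mult_right[OF has_integral_cis_K_0, of k c]
        has_integral_mult_right[OF has_integral_cis_0, of k c] by auto
  qed
next
  case (add f g)
  then obtain z w where "((\<lambda>y. f (K y)) has_integral z) {0..1}" "(f has_integral z) {0..1}"
    "((\<lambda>y. g (K y)) has_integral w) {0..1}" "(g has_integral w) {0..1}" by blast
  then show ?case by (intro exI[of _ "z + w"] conjI has_integral_add)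
qed

text \<open>By Stone-Weierstrass, \<open>F\<close> is uniformly close on the unit circle to a
  polynomial, and for polynomials both integrals agree.\<close>

lemma integral_circle_eq:
  fixes F :: "complex \<Rightarrow> real"
  assumes "continuous_on UNIV F"
  shows "integral {0..1} (\<lambda>y. F (cis (2 * pi * K y))) = integral {0..1} (\<lambda>y. F (cis (2 * pi * y)))"
    (is "?I = ?J")
proof -
  have int: "(\<lambda>y. F (cis (2 * pi * L y))) integrable_on {0..1}"
    if "continuous_on UNIV F" "continuous_on {0..1} L" for F :: "complex \<Rightarrow> real" and L :: "real \<Rightarrow> real"
    by (intro integrable_continuous_interval continuous_on_compose2[OF that(1)])
      (auto intro!: continuous_intros that(2))
  have "\<bar>?I - ?J\<bar> \<le> e" if "e > 0" for e
  proof -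
    obtain g where g: "real_polynomial_function g" "\<And>z. z \<in> sphere 0 1 \<Longrightarrow> \<bar>F z - g z\<bar> < e / 2"
      using Stone_Weierstrass_real_polynomial_function[of "sphere 0 1" F "e / 2"] \<open>e > 0\<close> assms
        continuous_on_subset[OF assms] by auto
    have cont_g: "continuous_on UNIV g"
      using g(1) by (simp add: continuous_on_polymonial_function real_polynomial_function_eq)
    obtain z where "((\<lambda>y. complex_of_real (g (cis (2 * pi * K y)))) has_integral z) {0..1}"
      "((\<lambda>y. complex_of_real (g (cis (2 * pi * y)))) has_integral z) {0..1}"
      using trig_polynomial_has_integral[OF trig_polynomial_of_real_polynomial[OF g(1)]] by auto
    from this[THEN has_integral_linear, OF bounded_linear_Re]
    have gg: "integral {0..1} (\<lambda>y. g (cis (2 * pi * K y))) = integral {0..1} (\<lambda>y. g (cis (2 * pi * y)))"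
      by (simp add: o_def integral_unique)
    \<comment> \<open>Used with \<open>L = K\<close> and with the identity; the two errors of
      \<open>e / 2\<close> add up to \<open>e\<close>.\<close>
    have close: "\<bar>integral {0..1} (\<lambda>y. F (cis (2 * pi * L y))) - integral {0..1} (\<lambda>y. g (cis (2 * pi * L y)))\<bar> \<le> e / 2"
      if L: "continuous_on {0..1} L" for L :: "real \<Rightarrow> real"
    proof -
      note int' = int[OF assms L] int[OF cont_g L]
      have "norm (integral {0..1} (\<lambda>y. F (cis (2 * pi * L y)) - g (cis (2 * pi * L y)))) \<le>
          integral {0..1} (\<lambda>y::real. e / 2)"
      proof (rule Henstock_Kurzweil_Integration.integral_norm_bound_integral)
        show "norm (F (cis (2 * pi * L y)) - g (cis (2 * pi * L y))) \<le> e / 2" for y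
          using g(2)[of "cis (2 * pi * L y)"] by simp
      qed (auto intro: integrable_diff[OF int'] integrable_continuous_interval)
      moreover note Henstock_Kurzweil_Integration.integral_diff[OF int']
      ultimately show ?thesis by (simp only:) simp
    qed
    show ?thesis
      using close[OF K_cont] close[of "\<lambda>y. y", OF continuous_on_id] gg by linarith
  qed
  note le = this
  have "\<bar>?I - ?J\<bar> \<le> 0"
  proof (rule field_le_epsilon)
    fix e :: real assume "e > 0"
    from le[OF this] show "\<bar>?I - ?J\<bar> \<le> 0 + e" by simp
  qed
  then show ?thesis by simp
qed

text \<open>The continuous functions \<open>F n\<close> converge pointwise to the indicator because
  \<open>A\<close> is closed, and dominated convergence applies. Nonemptiness matters because
  \<open>infdist z {} = 0\<close>.\<close>

lemma integral_indicator_circle_eq: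
  assumes "closed A" "A \<noteq> {}"
  shows "integral {0..1} (\<lambda>y. indicator A (cis (2 * pi * K y)) :: real) =
    integral {0..1} (\<lambda>y. indicator A (cis (2 * pi * y)))"
proof -
  define F where "F n z = max 0 (1 - real n * infdist z A)" for n and z :: complex
  have cont: "continuous_on UNIV (F n)" for n
    unfolding F_def by (intro continuous_intros)
  have lim: "(\<lambda>n. F n z) \<longlonglongrightarrow> indicator A z" for z
  proof (cases "z \<in> A")
    case True
    then show ?thesis by (simp add: F_def)
  next
    case False
    then have pos: "infdist z A > 0"
      using assms in_closed_iff_infdist_zero[OF assms] infdist_nonneg[of z A] by fastforce
    obtain N where N: "1 / infdist z A < real N" using reals_Archimedean2 by blast
    have "F n z = 0" if "n \<ge> N" for n
    proof -
      have "1 / infdist z A < real n" using N that by simp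
      then show ?thesis using pos by (simp add: F_def field_simps max_def)
    qed
    then show ?thesis
      using False by (intro tendsto_eventually) (auto simp: eventually_sequentially)
  qed
  have "norm (F n z) \<le> 1" for n z
    by (simp add: F_def infdist_nonneg)
  note bound = this
  have conv: "(\<lambda>n. integral {0..1} (\<lambda>y. F n (cis (2 * pi * L y)))) \<longlonglongrightarrow>
      integral {0..1} (\<lambda>y. indicator A (cis (2 * pi * L y)) :: real)"
    if L: "continuous_on {0..1} L" for L :: "real \<Rightarrow> real"
  proof (rule dominated_convergence(2)[where h = "\<lambda>_. 1"])
    show "(\<lambda>y. F n (cis (2 * pi * L y))) integrable_on {0..1}" for n
      by (intro integrable_continuous_interval continuous_on_compose2[OF cont])
        (auto intro!: continuous_intros L)
    show "(\<lambda>_. 1::real) integrable_on {0..1::real}"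
      by (intro integrable_continuous_interval continuous_on_const)
  qed (rule bound lim)+
  show ?thesis
    using conv[OF K_cont] conv[OF continuous_on_id]
    unfolding integral_circle_eq[OF cont] by (rule LIMSEQ_unique)
qed

text \<open>Equal points have parameters differing by an integer, here of modulus below 1. The value
  \<open>x = 1\<close> is excluded: it gives the same point as 0, which lies on every arc.\<close>

lemma cis_mem_arc_iff:
  assumes "0 \<le> s" "s < 1" "0 \<le> x" "x < 1"
  shows "cis (2 * pi * x) \<in> (\<lambda>t. cis (2 * pi * t)) ` {0..s} \<longleftrightarrow> x \<le> s"
proof
  assume "cis (2 * pi * x) \<in> (\<lambda>t. cis (2 * pi * t)) ` {0..s}"
  then obtain t where t: "0 \<le> t" "t \<le> s" "cis (2 * pi * x) = cis (2 * pi * t)" by auto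
  then obtain n :: int where "2 * pi * x = 2 * pi * t + 2 * pi * n"
    using sin_cos_eq_iff[of "2 * pi * x" "2 * pi * t"] by (auto simp: complex_eq_iff)
  then have "2 * pi * (x - t - n) = 0" by (simp add: algebra_simps)
  then have n: "x - t = n" by simp
  then have "\<bar>real_of_int n\<bar> < 1" using t assms by linarith
  then have "n = 0" by linarith
  then show "x \<le> s" using n t by simp
qed (use assms in auto)

text \<open>Since \<open>y \<le> H s\<close> is equivalent to \<open>K y \<le> s\<close>,
  \<open>H s\<close> is the \<nu>-measure of the arc up to \<open>s\<close>, and this equals its
  Lebesgue measure \<open>s\<close>.\<close>

lemma H_eq_self:
  assumes "s \<in> {0..1}"
  shows "H s = s"
proof (cases "s = 1")
  case False
  then have s: "0 \<le> s" "s < 1" using assms by auto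
  let ?A = "(\<lambda>t. cis (2 * pi * t)) ` {0..s}"
  have "compact ?A" by (intro compact_continuous_image continuous_intros) auto
  then have A: "closed ?A" "?A \<noteq> {}" using s by (auto intro: compact_imp_closed)
  have seg: "integral {0..1} (\<lambda>y. if y \<in> {0..t} then 1 else 0 :: real) = t" if "0 \<le> t" "t \<le> 1" for t
    using that has_integral_const_real[of "1::real" 0 t]
    by (intro integral_unique has_integral_restrict[THEN iffD2]) auto
  have K1: "K y < 1" "y \<le> H s \<longleftrightarrow> K y \<le> s" if "y \<in> {0..<1}" for y
  proof -
    have y: "y \<in> {0..1}" "K y \<in> {0..1}" using that K_mem[of y] by auto
    show "K y < 1" using H_K[OF y(1)] H_1 y(2) that by (cases "K y = 1") auto
    show "y \<le> H s \<longleftrightarrow> K y \<le> s"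
      using mono_onD[OF K_mono y(1) H_mem[OF assms]] mono_onD[OF H_mono y(2) assms] K_H[OF assms] H_K[OF y(1)]
      by auto
  qed
  have "H s = integral {0..1} (\<lambda>y. if y \<in> {0..H s} then 1 else 0 :: real)"
    using H_mem[OF assms] seg[of "H s"] by simp
  also have "\<dots> = integral {0..1} (\<lambda>y. indicator ?A (cis (2 * pi * K y)))"
  \<comment> \<open>At \<open>y = 1\<close> the point on the circle is that of 0, so the integrands
    may differ there; one point is negligible.\<close>
  proof (rule integral_spike[of "{1}"])
    fix y :: real assume "y \<in> {0..1} - {1}"
    then have y: "y \<in> {0..<1}" by auto
    then show "indicator ?A (cis (2 * pi * K y)) = (if y \<in> {0..H s} then 1 else 0 :: real)"
      using cis_mem_arc_iff[OF s, of "K y"] K1[OF y] K_mem[of y] by (simp add: indicator_def)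
  qed simp
  also have "\<dots> = integral {0..1} (\<lambda>y. indicator ?A (cis (2 * pi * y)))"
    by (rule integral_indicator_circle_eq[OF A])
  also have "\<dots> = integral {0..1} (\<lambda>y. if y \<in> {0..s} then 1 else 0 :: real)"
  proof (rule integral_spike[of "{1}"])
    fix y :: real assume "y \<in> {0..1} - {1}"
    then show "(if y \<in> {0..s} then 1 else 0 :: real) = indicator ?A (cis (2 * pi * y))"
      using cis_mem_arc_iff[OF s, of y] by (simp add: indicator_def)
  qed simp
  also have "\<dots> = s" using s by (intro seg) auto
  finally show ?thesis .
qed (simp add: H_1)

end

end

subsection \<open>Back to the circle\<close>

lemma to_circle_rep_circle [simp]: "to_circle (rep_circle c) = c"
  by (rule Quotient_abs_rep[OF Quotient_circle])

text \<open>The universal property of the quotient topology.\<close>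

lemma continuous_on_circleI:
  assumes "continuous_on UNIV (\<lambda>x. f (to_circle x))"
  shows "continuous_on UNIV f"
  using assms by (auto simp: continuous_on_open_vimage open_circle_def vimage_def)

lemma continuous_on_times_map: "continuous_on UNIV (times_map q)"
  by (intro continuous_on_circleI, unfold times_map.abs_eq)
    (intro continuous_on_compose2[OF continuous_on_to_circle[of UNIV]] continuous_intros subset_UNIV)

lemma periodic_rep_circle:
  fixes f :: "real \<Rightarrow> real"
  assumes "\<And>x y. x - y \<in> \<int> \<Longrightarrow> f x = f y"
  shows "f (rep_circle (to_circle x)) = f x"
  by (rule assms) (simp flip: to_circle_eq_iff)

lemma integral_circle_lebesgue:
  fixes g :: "circle \<Rightarrow> real"
  assumes "continuous_on UNIV g"
  shows "integral\<^sup>L circle_lebesgue g = integral {0..1} (\<lambda>y. g (to_circle y))"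
proof -
  have cont: "continuous_on S (\<lambda>y. g (to_circle y))" for S
    by (intro continuous_on_compose2[OF assms continuous_on_to_circle]) simp
  have int: "set_integrable lborel {0..<1} (\<lambda>y. g (to_circle y))"
  proof (rule set_integrable_subset[where A = "{0..1}"])
    show "set_integrable lborel {0..1} (\<lambda>y. g (to_circle y))"
      unfolding set_integrable_def by (intro borel_integrable_compact cont compact_Icc)
  qed auto
  have "integral\<^sup>L circle_lebesgue g = integral\<^sup>L (restrict_space lborel {0..<1}) (\<lambda>y. g (to_circle y))"
    unfolding circle_lebesgue_def
    by (intro integral_distr to_circle_measurable borel_measurable_continuous_onI assms)
  also have "\<dots> = (LINT y:{0..<1}|lborel. g (to_circle y))"
    by (simp add: integral_restrict_space set_lebesgue_integral_def)
  also have "\<dots> = integral {0..<1} (\<lambda>y. g (to_circle y))"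
    by (rule set_borel_integral_eq_integral(2)[OF int])
  also have "\<dots> = integral {0..1} (\<lambda>y. g (to_circle y))"
    by (rule integral_spike_set; rule negligible_subset[of "{1}"]) auto
  finally show ?thesis .
qed

text \<open>Invariance says that the image measure under \<open>F\<close> is again Lebesgue
  measure.\<close>

lemma preserves_lebesgue_integral_comp:
  fixes g :: "circle \<Rightarrow> real"
  assumes "preserves_lebesgue F" "continuous_on UNIV F" "continuous_on UNIV g"
  shows "integral\<^sup>L circle_lebesgue (\<lambda>c. g (F c)) = integral\<^sup>L circle_lebesgue g"
proof -
  have sets [simp, measurable_cong]: "sets circle_lebesgue = sets borel"
    and space [simp]: "space circle_lebesgue = UNIV"
    by (simp_all add: circle_lebesgue_def)
  have F [measurable]: "F \<in> circle_lebesgue \<rightarrow>\<^sub>M borel"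
    using borel_measurable_continuous_onI[OF assms(2)] by (simp add: measurable_def)
  have "distr circle_lebesgue borel F = circle_lebesgue"
  proof (rule measure_eqI)
    fix A assume "A \<in> sets (distr circle_lebesgue borel F)"
    then show "emeasure (distr circle_lebesgue borel F) A = emeasure circle_lebesgue A"
      using assms(1) by (simp add: emeasure_distr preserves_lebesgue_def)
  qed simp
  then have "integral\<^sup>L circle_lebesgue g = integral\<^sup>L (distr circle_lebesgue borel F) g" by simp
  also have "\<dots> = integral\<^sup>L circle_lebesgue (\<lambda>c. g (F c))"
    by (intro integral_distr F borel_measurable_continuous_onI assms)
  finally show ?thesis by simp
qed

lemma orientation_preserving_homeo_inv:
  assumes "orientation_preserving_homeo h"
  shows "continuous_on UNIV h" "continuous_on UNIV (inv_into UNIV h)" "inv_into UNIV h (h c) = c" "h (inv_into UNIV h c) = c"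
proof -
  obtain h' where h': "homeomorphism UNIV UNIV h h'"
    using assms by (auto simp: orientation_preserving_homeo_def)
  then have "h' (h c) = c" "h (h' c) = c" for c by (simp_all add: homeomorphism_def)
  then have "inv_into UNIV h = h'" by (intro inv_equality)
  then show "continuous_on UNIV h" "continuous_on UNIV (inv_into UNIV h)" "inv_into UNIV h (h c) = c" "h (inv_into UNIV h c) = c"
    using h' by (simp_all add: homeomorphism_def)
qed

lemma unit_interval_homeo_circle_lift:
  assumes "orientation_preserving_homeo h" "h 0 = 0"
  shows "unit_interval_homeo (circle_lift h) (the_inv_into {0..1} (circle_lift h))"
proof -
  note H = normalized_lift[OF assms] and bij = circle_lift_bij_betw[OF assms]
  have inj: "inj_on (circle_lift h) {0..1}" and image: "circle_lift h ` {0..1} = {0..1}"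
    using bij by (simp_all add: bij_betw_def)
  show ?thesis
  proof
    show "mono_on {0..1} (circle_lift h)"
      using H(3) by (intro mono_onI) (simp add: strict_mono_less_eq)
    have "continuous_on {0..1} (circle_lift h)"
      using H(1) by (auto simp: is_lift_def intro: continuous_on_subset)
    \<comment> \<open>A continuous injection on a compact set has a continuous inverse.\<close>
    from continuous_on_inv_into[OF this compact_Icc inj]
    show "continuous_on {0..1} (the_inv_into {0..1} (circle_lift h))" by (simp only: image)
  next
    fix y :: real assume "y \<in> {0..1}"
    then show "the_inv_into {0..1} (circle_lift h) y \<in> {0..1}"
      using the_inv_into_into[OF inj, of y "{0..1}"] image by simp
  next
    fix y :: real assume "y \<in> {0..1}"
    then show "circle_lift h (the_inv_into {0..1} (circle_lift h) y) = y"
      using f_the_inv_into_f[OF inj, of y] image by simp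
  qed (use H inj in \<open>auto simp: the_inv_into_f_f\<close>)
qed

text \<open>The inverse of \<open>h\<close> conjugates the given map to multiplication by
  \<open>q\<close> and carries Lebesgue measure to \<nu>. As \<open>K\<close> lifts this inverse on
  \<open>{0..1}\<close>, the average of a periodic \<open>f\<close> is an integral over the
  circle.\<close>

lemma avg_mult_invariant:
  fixes h q
  defines "H \<equiv> circle_lift h" and "K \<equiv> the_inv_into {0..1} (circle_lift h)"
  assumes h: "orientation_preserving_homeo h" "h 0 = 0"
    and pres: "preserves_lebesgue (conjugate_map h q)"
    and f: "continuous_on UNIV f" "\<And>x y. x - y \<in> \<int> \<Longrightarrow> f x = f y"
  shows "unit_interval_homeo.avg K (\<lambda>x. f (real q * x)) = unit_interval_homeo.avg K f"
proof -
  interpret unit_interval_homeo H K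
    unfolding H_def K_def by (rule unit_interval_homeo_circle_lift[OF h])
  note hinv = orientation_preserving_homeo_inv[OF h(1)]
  \<comment> \<open>\<open>rep_circle\<close> picks an arbitrary representative, which periodicity
    of \<open>f\<close> makes harmless.\<close>
  define g where "g = (\<lambda>c. f (rep_circle c))"
  have g: "g (to_circle x) = f x" for x
    unfolding g_def by (rule periodic_rep_circle[OF f(2)])
  have cont_g: "continuous_on UNIV g"
    by (rule continuous_on_circleI) (simp add: g f(1))
  have inv_K: "inv_into UNIV h (to_circle y) = to_circle (K y)" if "y \<in> {0..1}" for y
  proof -
    have "h (to_circle (K y)) = to_circle (H (K y))"
      using normalized_lift(1)[OF h] by (simp add: is_lift_def H_def)
    then show ?thesis using hinv(3)[of "to_circle (K y)"] H_K[OF that] by simp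
  qed
  have avg: "integral\<^sup>L circle_lebesgue (\<lambda>c. g' (inv_into UNIV h c)) = avg (\<lambda>x. g' (to_circle x))"
    if "continuous_on UNIV g'" for g'
    unfolding avg_def
    by (subst integral_circle_lebesgue)
      (auto intro!: continuous_on_compose2[OF that hinv(2)] integral_cong simp: inv_K)
  have F: "inv_into UNIV h (conjugate_map h q c) = times_map q (inv_into UNIV h c)" for c
    by (simp add: conjugate_map_def hinv)
  have "continuous_on UNIV (conjugate_map h q)"
    unfolding conjugate_map_def
    by (intro continuous_on_compose hinv(2) continuous_on_subset[OF continuous_on_times_map]
        continuous_on_subset[OF hinv(1)] subset_UNIV)
  from preserves_lebesgue_integral_comp[OF pres this continuous_on_compose2[OF cont_g hinv(2)]]
  have "integral\<^sup>L circle_lebesgue (\<lambda>c. g (times_map q (inv_into UNIV h c))) = integral\<^sup>L circle_lebesgue (\<lambda>c. g (inv_into UNIV h c))"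
    by (simp add: F)
  then show ?thesis
    using avg[OF cont_g] avg[OF continuous_on_compose2[OF cont_g continuous_on_times_map]]
    by (simp add: g times_map.abs_eq)
qed

lemma cos_sin_int_period:
  fixes a :: nat
  assumes "x - y \<in> \<int>"
  shows "cos (2 * pi * a * x) = cos (2 * pi * a * y)" "sin (2 * pi * a * x) = sin (2 * pi * a * y)"
proof -
  obtain n :: int where "x - y = n" using assms by (auto elim: Ints_cases)
  then have "x = y + n" by simp
  then have "2 * pi * a * x = 2 * pi * a * y + 2 * pi * of_int (int a * n)" by (simp add: algebra_simps)
  then show "cos (2 * pi * a * x) = cos (2 * pi * a * y)" "sin (2 * pi * a * x) = sin (2 * pi * a * y)"
    using sin_cos_eq_iff[of "2 * pi * a * x" "2 * pi * a * y"] by blast+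
qed

text \<open>The maximum over the finitely many branches is still below 1.\<close>

lemma lipschitz_property_uniform:
  assumes "lipschitz_property h p" "p > 0"
  shows "\<exists>c<1. \<forall>i<p. c-lipschitz_on {0..1} (inverse_branch h p i)"
proof -
  obtain c where c: "\<And>i. i < p \<Longrightarrow> c i < 1 \<and> (c i)-lipschitz_on {0..1} (inverse_branch h p i)"
    using assms(1) unfolding lipschitz_property_def by metis
  define m where "m = Max (c ` {..<p})"
  have "m < 1" unfolding m_def using c assms(2) by (subst Max_less_iff) auto
  moreover have "m-lipschitz_on {0..1} (inverse_branch h p i)" if "i < p" for i
  proof (rule lipschitz_on_le)
    show "(c i)-lipschitz_on {0..1} (inverse_branch h p i)" using c[OF that] by blast
    show "c i \<le> m" unfolding m_def using that by (intro Max_ge) auto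
  qed
  ultimately show ?thesis by blast
qed

text \<open>Asymmetric in \<open>p\<close> and \<open>q\<close>: contraction comes from
  \<open>p\<close> and invariance from \<open>q\<close>. The theorem applies it in either
  order.\<close>

lemma lipschitz_preserving_homeo_eq_id:
  fixes p q :: nat and h :: "circle \<Rightarrow> circle"
  assumes pq: "p > 1" "q > 1" "coprime p q"
    and h: "orientation_preserving_homeo h" "h 0 = 0"
    and pres: "preserves_lebesgue (conjugate_map h q)"
    and lip: "lipschitz_property h p"
  shows "h = id"
proof -
  define H where "H = circle_lift h"
  define K where "K = the_inv_into {0..1} (circle_lift h)"
  interpret unit_interval_homeo H K
    unfolding H_def K_def by (rule unit_interval_homeo_circle_lift[OF h])
  obtain c where c: "c < 1" "\<And>i. i < p \<Longrightarrow> c-lipschitz_on {0..1} (inverse_branch h p i)"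
    using lipschitz_property_uniform[OF lip] pq(1) by auto
  have branch: "inverse_branch h p i = (\<lambda>x. H ((K x + real i) / p))" for i
    by (simp add: fun_eq_iff inverse_branch_def H_def K_def)
  note inv = avg_mult_invariant[OF h pres, folded K_def]
  have inv_cos: "avg (\<lambda>x. cos (2 * pi * real (q * a) * x)) = avg (\<lambda>x. cos (2 * pi * real a * x))" for a
    using inv[of "\<lambda>x. cos (2 * pi * real a * x)"] cos_sin_int_period(1)[of _ _ a]
    by (simp add: mult_ac continuous_intros)
  have inv_sin: "avg (\<lambda>x. sin (2 * pi * real (q * a) * x)) = avg (\<lambda>x. sin (2 * pi * real a * x))" for a
    using inv[of "\<lambda>x. sin (2 * pi * real a * x)"] cos_sin_int_period(2)[of _ _ a]
    by (simp add: mult_ac continuous_intros)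
  note vanish = fourier_coefficients_vanish[OF pq c(1) _ c(2)[unfolded branch] inv_cos inv_sin]
  have H_id: "H s = s" if "s \<in> {0..1}" for s
    by (rule H_eq_self[OF _ _ that]) (auto intro!: vanish)
  show ?thesis
  proof
    fix c
    obtain x where "c = to_circle x" using to_circle_surj by blast
    \<comment> \<open>The representative in \<open>{0..<1}\<close> is taken because \<open>H\<close>
      is known to be the identity only on \<open>{0..1}\<close>.\<close>
    also have "to_circle x = to_circle (frac x)"
      by (simp add: to_circle_eq_iff frac_def)
    finally have x: "c = to_circle (frac x)" .
    have "h c = to_circle (H (frac x))"
      using normalized_lift(1)[OF h] by (simp add: is_lift_def H_def x)
    also have "H (frac x) = frac x"
      using frac_ge_0[of x] frac_lt_1[of x] by (intro H_id) auto
    finally show "h c = id c" using x by simp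
  qed
qed

theorem theorem3:
  fixes p q :: nat and h :: "circle \<Rightarrow> circle"
  assumes "p > 1" and "q > 1" and "coprime p q"
    and "orientation_preserving_homeo h" and "h 0 = 0"
    and "preserves_lebesgue (conjugate_map h p)"
    and "preserves_lebesgue (conjugate_map h q)"
    and "lipschitz_property h p \<or> lipschitz_property h q"
  shows "h = id"
  using assms(8)
proof
  assume "lipschitz_property h p"
  then show ?thesis by (rule lipschitz_preserving_homeo_eq_id[OF assms(1-5,7)])
next
  assume "lipschitz_property h q"
  then show ?thesis
    by (rule lipschitz_preserving_homeo_eq_id[OF assms(2,1) assms(3)[THEN coprime_commute[THEN iffD1]] assms(4-6)])
qed

end
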